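(* Let $f(x)=\mathbb{E}[F(x,\xi)]$ on $\mathbb{R}^d$, where the variable is partitioned as $x=(x^1,\dots,x^B)$ with $x^i\in\mathbb{R}^{d_i}$ and $\sum_{i=1}^B d_i=d$. Suppose that $F(\cdot,\xi)$ is convex on $\mathbb{R}^d$ for every $\xi$, and let $x^*$ be a minimizer of $f$ over $\mathbb{R}^d$. Let $(x_t)_{t\ge 1}$, $(g_t)_{t\ge1}$, $(s_t)_{t\ge1}$ be generated by the AdaGradBNG algorithm (defined in the context) with parameters $\delta>0$, $\eta>0$ and a deterministic starting point $x_1\in\mathbb{R}^d$. Suppose there are constants $M_1,\dots,M_B$ and $D_\infty>0$ such that, for all $t\ge 1$ and all $i=1,\dots,B$, almost surely $\|F_i'(x_t,\xi_t)\|_2\le M_i$ and $\|x_t-x^*\|_\infty\le D_\infty$. Let $H_t=\delta I_d+\mathrm{diag}(s_t)$, and for $T\ge 1$ let $\bar x_T=\frac1T\sum_{t=1}^T x_t$. Then for every $T\ge 1$, almost surely, $$\mathbb{E}[f(\bar x_T)-f(x^* )]\;\le\;\frac{\|x_1-x^*\|_{H_1}^2}{2\eta T}+\frac{D_\infty^2\sqrt{Bd}}{2\eta\sqrt{T}}+\sum_{i=1}^B\frac{\eta\,\mathbb{E}\left[M_i^2\sum_{j=d_1+\dots+d_{i-1}+1}^{d_1+\dots+d_i}\|g_{1:T,j}\|_2\right]}{T}$$ $$\le\;\frac{\|x_1-x^*\|_{H_1}^2}{2\eta T}+\frac{D_\infty^2\sqrt{Bd}}{2\eta\sqrt{T}}+\sum_{i=1}^B\frac{\eta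 M_i^2\sqrt{d_i}}{\sqrt{T}}.$$
   Context: Problem: minimize $f(x)=\mathbb{E}[F(x,\xi)]$ over $x\in\mathbb{R}^d$, where $\xi$ is a random variable with distribution $\mathbb{P}$, $F(\cdot,\xi)$ is a real-valued loss function for each $\xi$, and $f$ is finite. The coordinates of $\mathbb{R}^d$ are partitioned into $B$ consecutive blocks of sizes $d_1,\dots,d_B$; every vector $v\in\mathbb{R}^d$ is written $v=(v^1,\dots,v^B)$ with $v^i\in\mathbb{R}^{d_i}$. $F'(x,\xi)=(F_1'(x,\xi),\dots,F_B'(x,\xi))$ denotes a (measurably chosen) subgradient of $F(\cdot,\xi)$ at $x$, with $F_i'(x,\xi)\in\mathbb{R}^{d_i}$ its $i$th block. Notation: for a positive definite $d\times d$ matrix $W$, $\|x\|_W:=\sqrt{x^\top W x}$. $\circ$ is the coordinatewise (Hadamard) product. For a vector $v$ with nonzero entries, $v^{-1}$ is the vector of reciprocals of its entries. $\mathbf{1}_{n}$ is the all-ones vector in $\mathbb{R}^n$; $\mathrm{diag}(v)$ is the diagonal matrix with diagonal $v$. AdaGradBNG algorithm (AdaGrad with block-normalized gradient): choose $x_1\in\mathbb{R}^d$, $\delta>0$, $\eta>0$. For $t=1,2,\dots$: 1. Draw a sample $\xi_t\sim\mathbb{P}$ (independent over $t$) and set, for each block $i$, $g_t^i=F_i'(x_t,\xi_t)/\|F_i'(x_t,\xi_t)\|_2$ (it is assumed that $F_i'(x_t,\xi_t)\neq 0$, so that this is well defined and $\|g_t^i\|_2=1$). 2. Let $g_t=(g_t^1,\dots,g_t^B)\in\mathbb{R}^d$,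 let $g_{1:t}=[g_1,g_2,\dots,g_t]$ be the $d\times t$ matrix with columns $g_1,\dots,g_t$, let $g_{1:t,j}\in\mathbb{R}^t$ be its $j$th row, and let $s_t=(\|g_{1:t,1}\|_2,\dots,\|g_{1:t,d}\|_2)\in\mathbb{R}^d$, partitioned into blocks as $s_t=(s_t^1,\dots,s_t^B)$. 3. Let $\tau_t=(\tau_t^1,\dots,\tau_t^B)$ with $\tau_t^i=\eta\,\|F_i'(x_t,\xi_t)\|_2\,(\delta\mathbf{1}_{d_i}+s_t^i)^{-1}$. 4. Set $x_{t+1}=x_t-\tau_t\circ g_t$. The expectation $\mathbb{E}$ is over $\xi_1,\xi_2,\dots$. The matrix $H_1$ depends on the sample $\xi_1$, so the term $\|x_1-x^*\|_{H_1}^2$ is a random variable, and the inequalities are understood to hold almost surely. *)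

theory Defs
  imports "HOL-Probability.Probability"
begin

text \<open>
  The index type \<^typ>\<open>'n\<close> of \<^typ>\<open>real ^ 'n\<close> carries no order, so consecutive blocks are described
  through an enumeration \<open>crd\<close> of the coordinates: a bijection from \<open>{1..CARD('n)}\<close> to \<^typ>\<open>'n\<close>.
  The block sizes are \<open>ds 1, \<dots>, ds B\<close>, and \<open>v $ crd j\<close> is the \<open>j\<close>-th coordinate of \<open>v\<close>.
\<close>

definition block :: "(nat \<Rightarrow> nat) \<Rightarrow> nat \<Rightarrow> nat set" where
  "block ds i = {(\<Sum>k=1..<i. ds k) + 1 .. (\<Sum>k=1..i. ds k)}"

definition consecutive_blocks :: "nat \<Rightarrow> (nat \<Rightarrow> nat) \<Rightarrow> (nat \<Rightarrow> 'n::finite) \<Rightarrow> bool" where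
  "consecutive_blocks B ds crd \<longleftrightarrow>
     bij_betw crd {1..CARD('n)} UNIV \<and> (\<Sum>i=1..B. ds i) = CARD('n)"

definition block_norm :: "(nat \<Rightarrow> nat) \<Rightarrow> (nat \<Rightarrow> 'n) \<Rightarrow> nat \<Rightarrow> real ^ 'n \<Rightarrow> real" where
  "block_norm ds crd i v = L2_set (\<lambda>j. v $ crd j) (block ds i)"

definition is_subgradient :: "('a::real_inner \<Rightarrow> real) \<Rightarrow> 'a \<Rightarrow> 'a \<Rightarrow> bool" where
  "is_subgradient h x v \<longleftrightarrow> (\<forall>y. h y \<ge> h x + v \<bullet> (y - x))"

definition expected_loss :: "'x measure \<Rightarrow> (real ^ 'n \<Rightarrow> 'x \<Rightarrow> real) \<Rightarrow> real ^ 'n \<Rightarrow> real" where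
  "expected_loss P F x = (\<integral>z. F x z \<partial>P)"

definition diag :: "real ^ 'n \<Rightarrow> real ^ 'n ^ 'n" where
  "diag v = (\<chi> i j. if i = j then v $ i else 0)"

definition weighted_norm :: "real ^ 'n ^ 'n \<Rightarrow> real ^ 'n \<Rightarrow> real" where
  "weighted_norm W x = sqrt (x \<bullet> (W *v x))"

text \<open>The norm of row \<open>j\<close> of the matrix with columns \<open>g 1, \<dots>, g t\<close>.\<close>

definition row_norm :: "(nat \<Rightarrow> real ^ 'n) \<Rightarrow> nat \<Rightarrow> 'n \<Rightarrow> real" where
  "row_norm g t j = L2_set (\<lambda>k. g k $ j) {1..t}"

text \<open>
  One path of the algorithm, for the realized samples \<open>z 1, z 2, \<dots>\<close>; index 0 of the sequences
  is unused. The product \<open>\<tau> t * g t\<close> of vectors is the coordinatewise product. If a block of the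
  subgradient vanishes, division by zero makes the corresponding block of \<open>g t\<close> zero.
\<close>

definition adagrad_bng ::
  "nat \<Rightarrow> (nat \<Rightarrow> nat) \<Rightarrow> (nat \<Rightarrow> 'n::finite) \<Rightarrow> (real ^ 'n \<Rightarrow> 'x \<Rightarrow> real ^ 'n) \<Rightarrow> real \<Rightarrow> real \<Rightarrow> real ^ 'n \<Rightarrow>
   (nat \<Rightarrow> 'x) \<Rightarrow> (nat \<Rightarrow> real ^ 'n) \<Rightarrow> (nat \<Rightarrow> real ^ 'n) \<Rightarrow> (nat \<Rightarrow> real ^ 'n) \<Rightarrow> (nat \<Rightarrow> real ^ 'n) \<Rightarrow> bool"
where
  "adagrad_bng B ds crd F' \<delta> \<eta> x\<^sub>1 z x g s \<tau> \<longleftrightarrow>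
     x 1 = x\<^sub>1 \<and>
     (\<forall>t\<ge>1.
        (\<forall>i\<in>{1..B}. \<forall>j\<in>block ds i.
           g t $ crd j = F' (x t) (z t) $ crd j / block_norm ds crd i (F' (x t) (z t))) \<and>
        s t = (\<chi> j. row_norm g t j) \<and>
        (\<forall>i\<in>{1..B}. \<forall>j\<in>block ds i.
           \<tau> t $ crd j =
             \<eta> * block_norm ds crd i (F' (x t) (z t)) * inverse (\<delta> + s t $ crd j)) \<and>
        x (t + 1) = x t - \<tau> t * g t)"

end

theory Submission
  imports Defs
begin

text \<open>
  Since \<open>\<tau> t * g t\<close> equals \<open>\<eta> F' / (\<delta> + s t)\<close> coordinatewise, every coordinate runs a scalar AdaGrad
  recursion, and the usual telescoping gives a pathwise regret bound. Replacing the initial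
  weight \<open>\<delta> + s 1\<close> by \<open>\<delta>\<close> costs nothing, because the increment \<open>D\<^sup>2 (s T - s 1)\<close> of the telescoping
  sum leaves room for \<open>s 1 (x 1 - xs)\<^sup>2 \<le> D\<^sup>2 s 1\<close>. The resulting bound has a deterministic initial
  term that lies below the random \<open>H 1\<close>-norm for every outcome, so that it survives taking the
  expectation on the left only. Regret and expected excess loss are related by Fubini's theorem,
  as \<open>x t\<close> is a function of \<open>\<xi> 1, \<dots>, \<xi> (t - 1)\<close> and hence independent of \<open>\<xi> t\<close>.
\<close>

section \<open>Scalar AdaGrad inequalities for a single coordinate\<close>

text \<open>Each summand is at most twice the increment of the prefix norm, so the sum telescopes:
  with \<open>p\<close> and \<open>q\<close> the consecutive norms, the new square is
  \<open>(q - p) * (q + p)\<close>, and \<open>q + p\<close> is at most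
  \<open>2 * (\<delta> + q)\<close>.\<close>

lemma sum_square_div_L2_set_le:
  fixes a :: "nat \<Rightarrow> real"
  assumes "\<delta> > 0"
  shows "(\<Sum>t=1..T. (a t)\<^sup>2 / (\<delta> + L2_set a {1..t})) \<le> 2 * L2_set a {1..T}"
proof (induction T)
  case (Suc T)
  define p q where "p = L2_set a {1..T}" and "q = L2_set a {1..Suc T}"
  have "0 \<le> p" "0 \<le> q"
    by (simp_all add: p_def q_def)
  have q_sq: "q\<^sup>2 = p\<^sup>2 + (a (Suc T))\<^sup>2"
    by (simp add: p_def q_def L2_set_def sum_nonneg)
  with \<open>0 \<le> q\<close> have "p \<le> q"
    by (intro power2_le_imp_le[of p q]) auto
  have "(a (Suc T))\<^sup>2 = (q - p) * (q + p)"
    using q_sq by (simp add: power2_eq_square algebra_simps)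
  also have "\<dots> \<le> (q - p) * (2 * (\<delta> + q))"
    using \<open>p \<le> q\<close> assms by (intro mult_left_mono) auto
  finally have "(a (Suc T))\<^sup>2 \<le> (2 * q - 2 * p) * (\<delta> + q)"
    by (simp add: algebra_simps)
  then have "(a (Suc T))\<^sup>2 / (\<delta> + q) \<le> 2 * q - 2 * p"
    using assms \<open>0 \<le> q\<close> by (subst pos_divide_le_eq) auto
  with Suc.IH show ?case
    unfolding p_def q_def by simp
qed simp

lemma L2_set_prefix_mono:
  "m \<le> n \<Longrightarrow> L2_set a {1..m::nat} \<le> L2_set a {1..n}"
  unfolding L2_set_def by (intro real_sqrt_le_mono sum_mono2) auto

text \<open>Here \<open>u t\<close> stands for one coordinate of the distance to the minimizer and
  \<open>G t\<close> for that coordinate of the subgradient. Expanding the square of the update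
  expresses \<open>G t * u t\<close> through a difference of weighted squares, which telescopes up
  to the growth of the weights.\<close>

lemma weighted_descent_regret:
  fixes u G s :: "nat \<Rightarrow> real"
  assumes pos: "\<delta> > 0" "\<eta> > 0" and s0: "s 0 = 0" and s_mono: "\<And>t. s t \<le> s (Suc t)"
    and step: "\<And>t. t \<ge> 1 \<Longrightarrow> u (Suc t) = u t - \<eta> * G t / (\<delta> + s t)"
    and bound: "\<And>t. t \<in> {1..T} \<Longrightarrow> \<bar>u t\<bar> \<le> D"
  shows "(\<Sum>t=1..T. G t * u t)
    \<le> (\<delta> * (u 1)\<^sup>2 + D\<^sup>2 * s T) / (2 * \<eta>) + \<eta> / 2 * (\<Sum>t=1..T. (G t)\<^sup>2 / (\<delta> + s t))"
proof -
  have s_nonneg: "0 \<le> s t" for t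
    using lift_Suc_mono_le[of s 0 t] s_mono s0 by simp
  \<comment> \<open>The induction needs the stronger bound that keeps the negative term of the last
    iterate; it is discarded afterwards. At \<open>T = 0\<close> the two remaining terms cancel
    because \<open>s 0 = 0\<close>.\<close>
  have "(\<Sum>t=1..T. G t * u t)
    \<le> (\<delta> * (u 1)\<^sup>2 + D\<^sup>2 * s T) / (2 * \<eta>) + \<eta> / 2 * (\<Sum>t=1..T. (G t)\<^sup>2 / (\<delta> + s t))
      - (\<delta> + s T) * (u (Suc T))\<^sup>2 / (2 * \<eta>)"
    using bound
  proof (induction T)
    case (Suc T)
    let ?u = "u (Suc T)" and ?G = "G (Suc T)" and ?w = "\<delta> + s (Suc T)"
    have w: "?w > 0"
      using pos s_nonneg[of "Suc T"] by simp
    have descent: "?w * (u (Suc (Suc T)))\<^sup>2 = ?w * ?u\<^sup>2 - 2 * \<eta> * (?G * ?u) + \<eta>\<^sup>2 * (?G\<^sup>2 / ?w)"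
    proof -
      have "w * (v - \<eta> * G' / w)\<^sup>2 = w * v\<^sup>2 - 2 * \<eta> * (G' * v) + \<eta>\<^sup>2 * (G'\<^sup>2 / w)"
        if "w > 0" for w v G' :: real
        using that by (simp add: power2_eq_square field_simps)
      from this[OF w] show ?thesis
        by (simp add: step)
    qed
    have "?G * ?u = ?w * ?u\<^sup>2 / (2 * \<eta>) - ?w * (u (Suc (Suc T)))\<^sup>2 / (2 * \<eta>)
        + \<eta> / 2 * (?G\<^sup>2 / ?w)"
    proof -
      have "p = a / (2 * \<eta>) - b / (2 * \<eta>) + \<eta> / 2 * e"
        if "b = a - 2 * \<eta> * p + \<eta>\<^sup>2 * e" for a b e p :: real
        using that pos by (simp add: field_simps power2_eq_square)
      then show ?thesis
        using descent by blast
    qed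
    \<comment> \<open>Raising the weight of \<open>?u\<^sup>2\<close> from
      \<open>\<delta> + s T\<close> to \<open>\<delta> + s (Suc T)\<close> costs at most
      \<open>D\<^sup>2\<close> times the increment of \<open>s\<close>. Starting from
      \<open>s 0 = 0\<close>, these costs add up to \<open>D\<^sup>2 * s T\<close> and leave only
      \<delta> as the initial weight.\<close>
    moreover have "?u\<^sup>2 \<le> D\<^sup>2"
      using Suc.prems[of "Suc T"] by (intro power2_le_iff_abs_le[THEN iffD2]) auto
    then have "(s (Suc T) - s T) * ?u\<^sup>2 \<le> (s (Suc T) - s T) * D\<^sup>2"
      using s_mono by (intro mult_left_mono) auto
    then have "?w * ?u\<^sup>2 \<le> (\<delta> + s T) * ?u\<^sup>2 + (D\<^sup>2 * s (Suc T) - D\<^sup>2 * s T)"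
      by (simp add: algebra_simps)
    then have "?w * ?u\<^sup>2 / (2 * \<eta>)
        \<le> (\<delta> + s T) * ?u\<^sup>2 / (2 * \<eta>) + (D\<^sup>2 * s (Suc T) - D\<^sup>2 * s T) / (2 * \<eta>)"
      unfolding add_divide_distrib[symmetric] using pos by (intro divide_right_mono) auto
    moreover note Suc.IH[OF Suc.prems]
    ultimately show ?case
      by (simp add: algebra_simps add_divide_distrib diff_divide_distrib)
  qed (simp add: s0)
  moreover have "0 \<le> (\<delta> + s T) * (u (Suc T))\<^sup>2 / (2 * \<eta>)"
    using pos s_nonneg[of T] by simp
  ultimately show ?thesis
    by linarith
qed

text \<open>The weights accumulate the normalized \<open>g\<close>, whereas the step uses the raw
  \<open>G = n * g\<close>. Since \<open>(G t)\<^sup>2\<close> is at most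
  \<open>K\<^sup>2 * (g t)\<^sup>2\<close>, the quadratic term reduces to the telescoping sum for
  \<open>g\<close>, whose factor 2 cancels the 1/2 of the descent bound.\<close>

lemma normalized_adagrad_regret:
  fixes u G n g :: "nat \<Rightarrow> real"
  assumes pos: "\<delta> > 0" "\<eta> > 0"
    and G: "\<And>t. t \<ge> 1 \<Longrightarrow> G t = n t * g t"
    and step: "\<And>t. t \<ge> 1 \<Longrightarrow> u (Suc t) = u t - \<eta> * G t / (\<delta> + L2_set g {1..t})"
    and bound_u: "\<And>t. t \<in> {1..T} \<Longrightarrow> \<bar>u t\<bar> \<le> D"
    and bound_n: "\<And>t. t \<in> {1..T} \<Longrightarrow> \<bar>n t\<bar> \<le> K"
  shows "(\<Sum>t=1..T. G t * u t)
    \<le> (\<delta> * (u 1)\<^sup>2 + D\<^sup>2 * L2_set g {1..T}) / (2 * \<eta>) + \<eta> * K\<^sup>2 * L2_set g {1..T}"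
proof -
  have "(\<Sum>t=1..T. (G t)\<^sup>2 / (\<delta> + L2_set g {1..t}))
    \<le> (\<Sum>t=1..T. K\<^sup>2 * ((g t)\<^sup>2 / (\<delta> + L2_set g {1..t})))"
  proof (rule sum_mono)
    fix t assume t: "t \<in> {1..T}"
    have "(n t)\<^sup>2 \<le> K\<^sup>2"
      using bound_n[OF t] by (intro power2_le_iff_abs_le[THEN iffD2]) auto
    then have "(G t)\<^sup>2 \<le> K\<^sup>2 * (g t)\<^sup>2"
      using G[of t] t by (simp add: power_mult_distrib mult_right_mono)
    moreover have "0 < \<delta> + L2_set g {1..t}"
      using pos by (simp add: add_pos_nonneg)
    ultimately show "(G t)\<^sup>2 / (\<delta> + L2_set g {1..t}) \<le> K\<^sup>2 * ((g t)\<^sup>2 / (\<delta> + L2_set g {1..t}))"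
      by (simp add: divide_right_mono)
  qed
  also have "\<dots> \<le> K\<^sup>2 * (2 * L2_set g {1..T})"
    unfolding sum_distrib_left[symmetric]
    using sum_square_div_L2_set_le[OF pos(1), of g T] by (intro mult_left_mono) auto
  finally have "\<eta> / 2 * (\<Sum>t=1..T. (G t)\<^sup>2 / (\<delta> + L2_set g {1..t}))
      \<le> \<eta> * K\<^sup>2 * L2_set g {1..T}"
    using mult_left_mono[of _ _ "\<eta> / 2"] pos by fastforce
  \<comment> \<open>The weights are prefix norms of \<open>g\<close>; the empty prefix supplies the
    value 0 at time 0.\<close>
  moreover note weighted_descent_regret[of \<delta> \<eta> "\<lambda>t. L2_set g {1..t}" u G T D,
      OF pos _ _ step bound_u]
  ultimately show ?thesis
    using L2_set_prefix_mono[of _ "Suc _" g] by fastforce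
qed

section \<open>Sums over consecutive blocks, and elementary estimates\<close>

lemma sum_blocks:
  fixes h :: "nat \<Rightarrow> 'a::comm_monoid_add"
  shows "(\<Sum>i=1..B. \<Sum>j\<in>block ds i. h j) = (\<Sum>j\<in>{1..\<Sum>i=1..B. ds i}. h j)"
proof (induction B)
  case (Suc B)
  have "{1..\<Sum>i=1..Suc B. ds i} = {1..\<Sum>i=1..B. ds i} \<union> block ds (Suc B)"
    by (auto simp: block_def atLeastLessThanSuc_atLeastAtMost)
  then have "(\<Sum>j\<in>{1..\<Sum>i=1..Suc B. ds i}. h j)
      = (\<Sum>j\<in>{1..\<Sum>i=1..B. ds i} \<union> block ds (Suc B). h j)"
    by simp
  also have "\<dots> = (\<Sum>j\<in>{1..\<Sum>i=1..B. ds i}. h j) + (\<Sum>j\<in>block ds (Suc B). h j)"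
    by (intro sum.union_disjoint) (auto simp: block_def atLeastLessThanSuc_atLeastAtMost)
  finally show ?case
    using Suc.IH by simp
qed simp

lemma sum_consecutive_blocks:
  fixes crd :: "nat \<Rightarrow> 'n::finite" and h :: "'n \<Rightarrow> 'a::comm_monoid_add"
  assumes "consecutive_blocks B ds crd"
  shows "(\<Sum>i=1..B. \<Sum>j\<in>block ds i. h (crd j)) = (\<Sum>c\<in>UNIV. h c)"
proof -
  have crd: "bij_betw crd {1..CARD('n)} UNIV" and ds: "(\<Sum>i=1..B. ds i) = CARD('n)"
    using assms by (auto simp: consecutive_blocks_def)
  show ?thesis
    using sum.reindex_bij_betw[OF crd, of h] sum_blocks[where h = "\<lambda>j. h (crd j)"] ds by metis
qed

lemma finite_block [simp]: "finite (block ds i)"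
  by (simp add: block_def)

text \<open>The index 0 is excluded because that block is empty whatever the value of
  \<open>ds 0\<close>.\<close>

lemma card_block: "i \<ge> 1 \<Longrightarrow> card (block ds i) = ds i"
  by (cases i) (auto simp: block_def atLeastLessThanSuc_atLeastAtMost)

text \<open>A counting argument: the indicator of \<open>c\<close> sums to 1 over all coordinates,
  hence also over the blocks, so it cannot vanish on every block.\<close>

lemma coordinate_in_block:
  fixes crd :: "nat \<Rightarrow> 'n::finite"
  assumes "consecutive_blocks B ds crd"
  shows "\<exists>i\<in>{1..B}. \<exists>j\<in>block ds i. crd j = c"
proof (rule ccontr)
  assume "\<not> ?thesis"
  then have "(\<Sum>i=1..B. \<Sum>j\<in>block ds i. if crd j = c then 1 else 0 :: nat) = 0"
    by auto
  then show False
    using sum_consecutive_blocks[OF assms, of "\<lambda>c'. if c' = c then 1 else 0 :: nat"] by simp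
qed

lemma abs_nth_le_block_norm: "j \<in> block ds i \<Longrightarrow> \<bar>v $ crd j\<bar> \<le> block_norm ds crd i v"
  using member_le_L2_set[of "block ds i" j "\<lambda>j. \<bar>v $ crd j\<bar>"]
  by (simp add: block_norm_def L2_set_def)

text \<open>Cauchy-Schwarz against the all-ones vector. It serves both for a single block and for
  all coordinates together.\<close>

lemma sum_le_sqrt_card:
  fixes h :: "'a \<Rightarrow> real"
  assumes "(\<Sum>i\<in>A. (h i)\<^sup>2) \<le> C"
  shows "(\<Sum>i\<in>A. h i) \<le> sqrt (real (card A) * C)"
proof (rule real_le_rsqrt)
  have "(\<Sum>i\<in>A. h i)\<^sup>2 \<le> (\<Sum>i\<in>A. (h i)\<^sup>2) * real (card A)"
    by (rule sum_squared_le_sum_of_squares)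
  also have "\<dots> \<le> C * real (card A)"
    using assms by (intro mult_right_mono) auto
  finally show "(\<Sum>i\<in>A. h i)\<^sup>2 \<le> real (card A) * C"
    by (simp add: mult.commute)
qed

lemma borel_measurable_cart:
  fixes h :: "'a \<Rightarrow> real ^ 'n"
  assumes "\<And>c. (\<lambda>w. h w $ c) \<in> borel_measurable N"
  shows "h \<in> borel_measurable N"
  using assms by (subst borel_measurable_euclidean_space) (auto simp: Basis_vec_def inner_axis)

lemma borel_measurable_nth [measurable (raw)]:
  fixes h :: "'a \<Rightarrow> real ^ 'n"
  assumes "h \<in> borel_measurable N"
  shows "(\<lambda>w. h w $ c) \<in> borel_measurable N"
  by (rule borel_measurable_continuous_on[OF _ assms]) (intro continuous_intros)

lemma borel_measurable_L2_set [measurable (raw)]: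
  assumes "\<And>k. k \<in> A \<Longrightarrow> (\<lambda>w. h w k) \<in> borel_measurable N"
  shows "(\<lambda>w. L2_set (h w) A) \<in> borel_measurable N"
  unfolding L2_set_def using assms by measurable

section \<open>Independence of an iterate from the current sample, and the expected excess
  loss\<close>

context prob_space
begin

text \<open>The state at time \<open>t\<close> has consumed only the samples before
  \<open>t\<close>. At time 1 the index set is empty and the factoring map is constant, because the
  start is deterministic.\<close>

lemma recursion_factors_through_past:
  assumes \<Phi>: "(\<lambda>(y, z). \<Phi> y z) \<in> S \<Otimes>\<^sub>M P \<rightarrow>\<^sub>M S" and y0: "y0 \<in> space S"
    and init: "\<And>\<omega>. \<omega> \<in> space M \<Longrightarrow> X 1 \<omega> = y0"
    and step: "\<And>t \<omega>. t \<ge> 1 \<Longrightarrow> \<omega> \<in> space M \<Longrightarrow> X (Suc t) \<omega> = \<Phi> (X t \<omega>) (Z t \<omega>)"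
    and "t \<ge> 1"
  shows "\<exists>h \<in> (\<Pi>\<^sub>M i\<in>{1..<t}. P) \<rightarrow>\<^sub>M S. \<forall>\<omega>\<in>space M. X t \<omega> = h (\<lambda>i\<in>{1..<t}. Z i \<omega>)"
  using \<open>t \<ge> 1\<close>
proof (induction t rule: dec_induct)
  case base
  show ?case
    by (intro bexI[of _ "\<lambda>_. y0"]) (use y0 init in auto)
next
  case (step t)
  then obtain h where h [measurable]: "h \<in> (\<Pi>\<^sub>M i\<in>{1..<t}. P) \<rightarrow>\<^sub>M S"
    and X: "\<And>\<omega>. \<omega> \<in> space M \<Longrightarrow> X t \<omega> = h (\<lambda>i\<in>{1..<t}. Z i \<omega>)"
    by blast
  \<comment> \<open>The witness recovers the previous state from the samples before \<open>t\<close>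
    and feeds it together with the sample \<open>t\<close> into \<open>\<Phi>\<close>.\<close>
  let ?h = "\<lambda>z. \<Phi> (h (restrict z {1..<t})) (z t)"
  have "(\<lambda>z. restrict z {1..<t}) \<in> (\<Pi>\<^sub>M i\<in>{1..<Suc t}. P) \<rightarrow>\<^sub>M (\<Pi>\<^sub>M i\<in>{1..<t}. P)"
    by (rule measurable_restrict_subset) auto
  moreover have "(\<lambda>z. z t) \<in> (\<Pi>\<^sub>M i\<in>{1..<Suc t}. P) \<rightarrow>\<^sub>M P"
    using step by (intro measurable_component_singleton) auto
  ultimately have "(\<lambda>z. (h (restrict z {1..<t}), z t)) \<in> (\<Pi>\<^sub>M i\<in>{1..<Suc t}. P) \<rightarrow>\<^sub>M S \<Otimes>\<^sub>M P"
    by measurable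
  from measurable_compose[OF this \<Phi>] have "?h \<in> (\<Pi>\<^sub>M i\<in>{1..<Suc t}. P) \<rightarrow>\<^sub>M S"
    by simp
  moreover have "X (Suc t) \<omega> = ?h (\<lambda>i\<in>{1..<Suc t}. Z i \<omega>)" if "\<omega> \<in> space M" for \<omega>
  proof -
    have "restrict (\<lambda>i\<in>{1..<Suc t}. Z i \<omega>) {1..<t} = (\<lambda>i\<in>{1..<t}. Z i \<omega>)"
      by auto
    then show ?thesis
      using that \<open>1 \<le> t\<close> by (simp only: assms(4) X) simp
  qed
  ultimately show ?case
    by (intro bexI[of _ ?h]) blast
qed

text \<open>This puts independence of state and sample into the form used by Fubini: the joint law
  is the product of the marginals. The map \<open>k\<close> allows passing to a part of the state,
  such as the iterate without the auxiliary component that makes the recursion closed.\<close>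

lemma joint_distribution_recursion:
  assumes indep: "indep_vars (\<lambda>_. P) Z {1..}"
    and \<Phi>: "(\<lambda>(y, z). \<Phi> y z) \<in> S \<Otimes>\<^sub>M P \<rightarrow>\<^sub>M S" and y0: "y0 \<in> space S"
    and init: "\<And>\<omega>. \<omega> \<in> space M \<Longrightarrow> X 1 \<omega> = y0"
    and step: "\<And>t \<omega>. t \<ge> 1 \<Longrightarrow> \<omega> \<in> space M \<Longrightarrow> X (Suc t) \<omega> = \<Phi> (X t \<omega>) (Z t \<omega>)"
    and k: "k \<in> S \<rightarrow>\<^sub>M N" and "t \<ge> 1"
  shows "(\<lambda>\<omega>. k (X t \<omega>)) \<in> M \<rightarrow>\<^sub>M N"
    and "distr M N (\<lambda>\<omega>. k (X t \<omega>)) \<Otimes>\<^sub>M distr M P (Z t)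
      = distr M (N \<Otimes>\<^sub>M P) (\<lambda>\<omega>. (k (X t \<omega>), Z t \<omega>))"
proof -
  obtain h where h: "h \<in> (\<Pi>\<^sub>M i\<in>{1..<t}. P) \<rightarrow>\<^sub>M S"
    and X: "\<And>\<omega>. \<omega> \<in> space M \<Longrightarrow> X t \<omega> = h (\<lambda>i\<in>{1..<t}. Z i \<omega>)"
    using recursion_factors_through_past[where X = X and Z = Z, OF \<Phi> y0 init step \<open>t \<ge> 1\<close>]
    by blast
  \<comment> \<open>Sample families over the disjoint index sets \<open>{1..<t}\<close> and
    \<open>{t}\<close> are independent. The state is a function of \<open>U\<close>, and
    \<open>Z t\<close> is the single component of \<open>V\<close>.\<close>
  define U where "U = (\<lambda>\<omega>. \<lambda>i\<in>{1..<t}. Z i \<omega>)"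
  define V where "V = (\<lambda>\<omega>. \<lambda>i\<in>{t}. Z i \<omega>)"
  let ?A = "\<Pi>\<^sub>M i\<in>{1..<t}. P" and ?B = "\<Pi>\<^sub>M i\<in>{t}. P"
  have "indep_var ?A U ?B V"
    unfolding U_def V_def using \<open>t \<ge> 1\<close> by (intro indep_var_restrict[OF indep]) auto
  then have U [measurable]: "U \<in> M \<rightarrow>\<^sub>M ?A" and V [measurable]: "V \<in> M \<rightarrow>\<^sub>M ?B"
    and UV: "distr M ?A U \<Otimes>\<^sub>M distr M ?B V = distr M (?A \<Otimes>\<^sub>M ?B) (\<lambda>\<omega>. (U \<omega>, V \<omega>))"
    unfolding indep_var_distribution_eq by auto
  have kh [measurable]: "(\<lambda>w. k (h w)) \<in> ?A \<rightarrow>\<^sub>M N"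
    using measurable_compose[OF h k] .
  have pr [measurable]: "(\<lambda>z. z t) \<in> ?B \<rightarrow>\<^sub>M P"
    by (rule measurable_component_singleton) simp
  have Z: "Z t = (\<lambda>\<omega>. V \<omega> t)"
    by (auto simp: V_def)
  have "(\<lambda>\<omega>. k (h (U \<omega>))) \<in> M \<rightarrow>\<^sub>M N"
    using measurable_compose[OF U kh] .
  then show "(\<lambda>\<omega>. k (X t \<omega>)) \<in> M \<rightarrow>\<^sub>M N"
    by (rule measurable_cong[THEN iffD1, rotated]) (simp add: X U_def)
  have "distr M N (\<lambda>\<omega>. k (X t \<omega>)) = distr M N (\<lambda>\<omega>. k (h (U \<omega>)))"
    by (intro distr_cong) (auto simp: X U_def)
  also have "\<dots> = distr (distr M ?A U) N (\<lambda>w. k (h w))"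
    by (simp only: distr_distr[OF kh U] comp_def)
  finally have 1: "distr M N (\<lambda>\<omega>. k (X t \<omega>)) = distr (distr M ?A U) N (\<lambda>w. k (h w))" .
  have 2: "distr M P (Z t) = distr (distr M ?B V) P (\<lambda>z. z t)"
    by (simp only: Z distr_distr[OF pr V] comp_def)
  \<comment> \<open>A product of push-forwards is the push-forward of the product once the second
    push-forward is sigma-finite.\<close>
  have "prob_space (distr (distr M ?B V) P (\<lambda>z. z t))"
    by (intro prob_space.prob_space_distr prob_space_distr) auto
  then have "sigma_finite_measure (distr (distr M ?B V) P (\<lambda>z. z t))"
    using finite_measure.axioms(1) prob_space.axioms(1) by blast
  then have "distr M N (\<lambda>\<omega>. k (X t \<omega>)) \<Otimes>\<^sub>M distr M P (Z t)
      = distr (distr M ?A U \<Otimes>\<^sub>M distr M ?B V) (N \<Otimes>\<^sub>M P) (\<lambda>(w, z). (k (h w), z t))"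
    unfolding 1 2 by (intro pair_measure_distr) (use kh pr in auto)
  also have "\<dots> = distr M (N \<Otimes>\<^sub>M P) (\<lambda>\<omega>. (k (h (U \<omega>)), V \<omega> t))"
  proof -
    have khpr: "(\<lambda>(w, z). (k (h w), z t)) \<in> ?A \<Otimes>\<^sub>M ?B \<rightarrow>\<^sub>M N \<Otimes>\<^sub>M P"
      by measurable
    show ?thesis
      by (simp only: UV distr_distr[OF khpr measurable_Pair[OF U V]] comp_def prod.case)
  qed
  also have "\<dots> = distr M (N \<Otimes>\<^sub>M P) (\<lambda>\<omega>. (k (X t \<omega>), Z t \<omega>))"
    by (intro distr_cong) (auto simp: X U_def Z)
  finally show "distr M N (\<lambda>\<omega>. k (X t \<omega>)) \<Otimes>\<^sub>M distr M P (Z t)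
      = distr M (N \<Otimes>\<^sub>M P) (\<lambda>\<omega>. (k (X t \<omega>), Z t \<omega>))" .
qed

text \<open>For a fixed point \<open>y\<close>, integrating the subgradient inequality over
  \<open>P\<close> bounds the excess loss at \<open>y\<close> by a mean inner product. Integrating
  over the law of \<open>X\<close> and applying Fubini through \<open>joint\<close> turns this into
  the expectation along the random point.\<close>

lemma expected_excess_le_expected_subgradient:
  fixes P :: "'x measure" and F :: "real ^ 'n \<Rightarrow> 'x \<Rightarrow> real"
  assumes P: "prob_space P"
    and X [measurable]: "X \<in> borel_measurable M" and Z [measurable]: "Z \<in> M \<rightarrow>\<^sub>M P"
    and joint: "distr M borel X \<Otimes>\<^sub>M P = distr M (borel \<Otimes>\<^sub>M P) (\<lambda>\<omega>. (X \<omega>, Z \<omega>))"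
    and F: "\<And>y. integrable P (F y)"
    and subgrad: "\<And>y z. z \<in> space P \<Longrightarrow> is_subgradient (\<lambda>y. F y z) y (F' y z)"
    and F' [measurable]: "(\<lambda>(y, z). F' y z) \<in> borel_measurable (borel \<Otimes>\<^sub>M P)"
    and meas [measurable]: "expected_loss P F \<in> borel_measurable borel"
    and int: "integrable M (\<lambda>\<omega>. F' (X \<omega>) (Z \<omega>) \<bullet> (X \<omega> - xs))"
    and int': "integrable M (\<lambda>\<omega>. expected_loss P F (X \<omega>) - expected_loss P F xs)"
  shows "(\<integral>\<omega>. expected_loss P F (X \<omega>) - expected_loss P F xs \<partial>M)
    \<le> (\<integral>\<omega>. F' (X \<omega>) (Z \<omega>) \<bullet> (X \<omega> - xs) \<partial>M)"
proof -
  let ?f = "expected_loss P F" and ?G = "\<lambda>(y, z). F' y z \<bullet> (y - xs)"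
  define Q where "Q = distr M borel X"
  note joint = joint[folded Q_def]
  have [simp]: "sets Q = sets borel" "space Q = UNIV"
    by (simp_all add: Q_def)
  interpret P: prob_space P by fact
  interpret Q: prob_space Q
    unfolding Q_def by (rule prob_space_distr) measurable
  interpret QP: pair_sigma_finite Q P ..
  have XZ: "(\<lambda>\<omega>. (X \<omega>, Z \<omega>)) \<in> M \<rightarrow>\<^sub>M borel \<Otimes>\<^sub>M P"
    by measurable
  have G: "?G \<in> borel_measurable (borel \<Otimes>\<^sub>M P)"
  proof -
    have "(\<lambda>p. (\<lambda>(y, z). F' y z) p \<bullet> (fst p - xs)) \<in> borel_measurable (borel \<Otimes>\<^sub>M P)"
      by measurable
    then show ?thesis
      by (simp add: case_prod_beta')
  qed
  have G_int: "integrable (Q \<Otimes>\<^sub>M P) ?G"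
    unfolding joint using int by (subst integrable_distr_eq[OF XZ G]) simp
  have "(\<integral>\<omega>. ?f (X \<omega>) - ?f xs \<partial>M) = (\<integral>y. ?f y - ?f xs \<partial>Q)"
    unfolding Q_def by (subst integral_distr) auto
  also have "\<dots> \<le> (\<integral>y. (\<integral>z. ?G (y, z) \<partial>P) \<partial>Q)"
  proof (rule integral_mono_AE)
    show "integrable Q (\<lambda>y. ?f y - ?f xs)"
      unfolding Q_def using int' by (subst integrable_distr_eq) auto
    show "integrable Q (\<lambda>y. \<integral>z. ?G (y, z) \<partial>P)"
      using QP.integrable_fst'[OF G_int] .
    \<comment> \<open>Fubini makes the inner integrand integrable only for almost every
      \<open>y\<close>, so the comparison is made almost everywhere.\<close>
    show "AE y in Q. ?f y - ?f xs \<le> (\<integral>z. ?G (y, z) \<partial>P)"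
      using QP.AE_integrable_fst'[OF G_int]
    proof eventually_elim
      case (elim y)
      have "?f y - ?f xs = (\<integral>z. F y z - F xs z \<partial>P)"
        unfolding expected_loss_def using F by simp
      also have "\<dots> \<le> (\<integral>z. ?G (y, z) \<partial>P)"
      proof (rule integral_mono[OF _ elim])
        fix z assume "z \<in> space P"
        then have "F xs z \<ge> F y z + F' y z \<bullet> (xs - y)"
          using subgrad unfolding is_subgradient_def by blast
        then show "F y z - F xs z \<le> ?G (y, z)"
          by (simp add: inner_diff_right)
      qed (use F in simp)
      finally show ?case .
    qed
  qed
  also have "\<dots> = integral\<^sup>L (Q \<Otimes>\<^sub>M P) ?G"
    by (rule QP.integral_fst'[OF G_int])
  also have "\<dots> = (\<integral>\<omega>. F' (X \<omega>) (Z \<omega>) \<bullet> (X \<omega> - xs) \<partial>M)"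
    unfolding joint by (subst integral_distr[OF XZ G]) simp
  finally show ?thesis .
qed

end

lemma convex_on_expected_loss:
  fixes F :: "real ^ 'n \<Rightarrow> 'x \<Rightarrow> real"
  assumes "\<And>y. integrable P (F y)"
    and "\<And>z. z \<in> space P \<Longrightarrow> convex_on UNIV (\<lambda>y. F y z)"
  shows "convex_on UNIV (expected_loss P F)"
proof (rule convex_onI)
  fix t :: real and y y' :: "real ^ 'n"
  assume t: "0 < t" "t < 1"
  have "expected_loss P F ((1 - t) *\<^sub>R y + t *\<^sub>R y') \<le> (\<integral>z. (1 - t) * F y z + t * F y' z \<partial>P)"
    unfolding expected_loss_def using assms t
    by (intro integral_mono convex_onD[OF assms(2)]) auto
  also have "\<dots> = (1 - t) * expected_loss P F y + t * expected_loss P F y'"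
    unfolding expected_loss_def using assms by simp
  finally show "expected_loss P F ((1 - t) *\<^sub>R y + t *\<^sub>R y')
    \<le> (1 - t) * expected_loss P F y + t * expected_loss P F y'" .
qed simp


section \<open>Pathwise analysis of the algorithm\<close>

lemma norm_square_cart: "(norm (y :: real ^ 'n))\<^sup>2 = (\<Sum>c\<in>UNIV. (y $ c)\<^sup>2)"
  by (simp add: norm_vec_def L2_set_def sum_nonneg)

text \<open>This inverts the normalization. When the block norm is zero, all coordinates of the
  block are zero, so the product form agrees with the convention for division by zero.\<close>

lemma adagrad_bng_normalization:
  assumes "adagrad_bng B ds crd F' \<delta> \<eta> x\<^sub>1 z x g s \<tau>" "t \<ge> 1" "i \<in> {1..B}" "j \<in> block ds i"
  shows "F' (x t) (z t) $ crd j = block_norm ds crd i (F' (x t) (z t)) * g t $ crd j"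
proof (cases "block_norm ds crd i (F' (x t) (z t)) = 0")
  case True
  then show ?thesis
    using abs_nth_le_block_norm[OF assms(4), of "F' (x t) (z t)" crd] by simp
next
  case False
  then show ?thesis
    using assms unfolding adagrad_bng_def by simp
qed

text \<open>The block norm in \<open>\<tau>\<close> cancels the one dividing the subgradient in
  \<open>g\<close>: the step follows the raw subgradient, and normalization survives only in the
  weights.\<close>

lemma adagrad_bng_step:
  assumes alg: "adagrad_bng B ds crd F' \<delta> \<eta> x\<^sub>1 z x g s \<tau>" and "consecutive_blocks B ds crd"
    and "t \<ge> 1"
  shows "x (Suc t) $ c = x t $ c - \<eta> * F' (x t) (z t) $ c / (\<delta> + row_norm g t c)"
proof -
  obtain i j where ij: "i \<in> {1..B}" "j \<in> block ds i" "crd j = c"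
    using coordinate_in_block[OF assms(2)] by blast
  have "\<tau> t $ c = \<eta> * block_norm ds crd i (F' (x t) (z t)) * inverse (\<delta> + row_norm g t c)"
    and "x (Suc t) = x t - \<tau> t * g t"
    using alg ij \<open>t \<ge> 1\<close> unfolding adagrad_bng_def by auto
  then show ?thesis
    using adagrad_bng_normalization[OF alg \<open>t \<ge> 1\<close> ij(1,2)] ij(3)
    by (simp add: divide_inverse mult_ac)
qed

text \<open>The sum is 1 for a nonzero block norm and 0 under division by zero; the inequality
  covers both cases.\<close>

lemma adagrad_bng_block_le_1:
  assumes alg: "adagrad_bng B ds crd F' \<delta> \<eta> x\<^sub>1 z x g s \<tau>" and t: "t \<ge> 1" and i: "i \<in> {1..B}"
  shows "(\<Sum>j\<in>block ds i. (g t $ crd j)\<^sup>2) \<le> 1"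
proof -
  let ?v = "F' (x t) (z t)"
  have "(\<Sum>j\<in>block ds i. (g t $ crd j)\<^sup>2) = (\<Sum>j\<in>block ds i. (?v $ crd j)\<^sup>2 / (block_norm ds crd i ?v)\<^sup>2)"
    using alg t i unfolding adagrad_bng_def by (intro sum.cong) (auto simp: power_divide)
  also have "\<dots> = (\<Sum>j\<in>block ds i. (?v $ crd j)\<^sup>2) / (block_norm ds crd i ?v)\<^sup>2"
    by (simp add: sum_divide_distrib)
  also have "\<dots> \<le> 1"
    by (simp add: block_norm_def L2_set_def sum_nonneg divide_le_eq_1)
  finally show ?thesis .
qed

text \<open>Counting the squared entries of the block by columns instead of rows, each of the
  \<open>T\<close> columns contributes at most 1.\<close>

lemma adagrad_bng_sum_row_norm_square:
  assumes alg: "adagrad_bng B ds crd F' \<delta> \<eta> x\<^sub>1 z x g s \<tau>" and i: "i \<in> {1..B}"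
  shows "(\<Sum>j\<in>block ds i. (row_norm g T (crd j))\<^sup>2) \<le> real T"
proof -
  have "(\<Sum>j\<in>block ds i. (row_norm g T (crd j))\<^sup>2)
      = (\<Sum>k=1..T. \<Sum>j\<in>block ds i. (g k $ crd j)\<^sup>2)"
    unfolding row_norm_def L2_set_def by (subst sum.swap) (simp add: sum_nonneg)
  also have "\<dots> \<le> (\<Sum>k=1..T. 1)"
    using adagrad_bng_block_le_1[OF alg _ i] by (intro sum_mono) auto
  finally show ?thesis
    by simp
qed

lemma adagrad_bng_sum_row_norm_block:
  assumes "adagrad_bng B ds crd F' \<delta> \<eta> x\<^sub>1 z x g s \<tau>" "i \<in> {1..B}"
  shows "(\<Sum>j\<in>block ds i. row_norm g T (crd j)) \<le> sqrt (real (ds i) * real T)"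
  using sum_le_sqrt_card[OF adagrad_bng_sum_row_norm_square[OF assms]] assms(2)
  by (simp add: card_block)

text \<open>The origin of the factor \<open>sqrt (B * d)\<close> in the rate: the \<open>B\<close>
  blocks together have squared mass at most \<open>B * T\<close>, to which Cauchy-Schwarz is applied
  over all coordinates at once.\<close>

lemma adagrad_bng_sum_row_norm:
  fixes crd :: "nat \<Rightarrow> 'n::finite"
  assumes alg: "adagrad_bng B ds crd F' \<delta> \<eta> x\<^sub>1 z x g s \<tau>" and blocks: "consecutive_blocks B ds crd"
  shows "(\<Sum>c\<in>UNIV. row_norm g T c) \<le> sqrt (real CARD('n) * (real B * real T))"
proof (rule sum_le_sqrt_card)
  have "(\<Sum>c\<in>UNIV. (row_norm g T c)\<^sup>2) = (\<Sum>i=1..B. \<Sum>j\<in>block ds i. (row_norm g T (crd j))\<^sup>2)"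
    by (rule sum_consecutive_blocks[OF blocks, symmetric])
  also have "\<dots> \<le> (\<Sum>i=1..B. real T)"
    using adagrad_bng_sum_row_norm_square[OF alg] by (intro sum_mono)
  finally show "(\<Sum>c\<in>UNIV. (row_norm g T c)\<^sup>2) \<le> real B * real T"
    by simp
qed

text \<open>The scalar regret bound is summed over coordinates, grouped by block because the
  gradient bound \<open>Mb i\<close> belongs to a block.\<close>

lemma adagrad_bng_regret:
  fixes crd :: "nat \<Rightarrow> 'n::finite"
  assumes alg: "adagrad_bng B ds crd F' \<delta> \<eta> x\<^sub>1 z x g s \<tau>" and blocks: "consecutive_blocks B ds crd"
    and pos: "\<delta> > 0" "\<eta> > 0"
    and bound_x: "\<And>t. t \<in> {1..T} \<Longrightarrow> infnorm (x t - xs) \<le> D"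
    and bound_F': "\<And>t i. t \<in> {1..T} \<Longrightarrow> i \<in> {1..B} \<Longrightarrow> block_norm ds crd i (F' (x t) (z t)) \<le> Mb i"
  shows "(\<Sum>t=1..T. F' (x t) (z t) \<bullet> (x t - xs))
    \<le> (\<delta> * (norm (x\<^sub>1 - xs))\<^sup>2 + D\<^sup>2 * sqrt (real CARD('n) * (real B * real T))) / (2 * \<eta>)
      + (\<Sum>i=1..B. \<eta> * ((Mb i)\<^sup>2 * (\<Sum>j\<in>block ds i. row_norm g T (crd j))))"
proof -
  let ?G = "\<lambda>t. F' (x t) (z t)" and ?r = "row_norm g T"
  have x1: "x 1 = x\<^sub>1"
    using alg by (simp add: adagrad_bng_def)
  have coord: "(\<Sum>t=1..T. ?G t $ crd j * (x t - xs) $ crd j)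
      \<le> (\<delta> * ((x\<^sub>1 - xs) $ crd j)\<^sup>2 + D\<^sup>2 * ?r (crd j)) / (2 * \<eta>) + \<eta> * (Mb i)\<^sup>2 * ?r (crd j)"
    if i: "i \<in> {1..B}" and j: "j \<in> block ds i" for i j
    unfolding row_norm_def x1[symmetric]
  proof (rule normalized_adagrad_regret[OF pos])
    show "?G t $ crd j = block_norm ds crd i (?G t) * g t $ crd j" if "t \<ge> 1" for t
      using adagrad_bng_normalization[OF alg that i j] .
    show "(x (Suc t) - xs) $ crd j
        = (x t - xs) $ crd j - \<eta> * ?G t $ crd j / (\<delta> + L2_set (\<lambda>k. g k $ crd j) {1..t})"
      if "t \<ge> 1" for t
      using adagrad_bng_step[OF alg blocks that, of "crd j"] by (simp add: row_norm_def)
    show "\<bar>(x t - xs) $ crd j\<bar> \<le> D" if "t \<in> {1..T}" for t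
      using component_le_infnorm_cart[of "x t - xs" "crd j"] bound_x[OF that] by linarith
    show "\<bar>block_norm ds crd i (?G t)\<bar> \<le> Mb i" if "t \<in> {1..T}" for t
      using bound_F'[OF that i] by (simp add: block_norm_def)
  qed
  have "(\<Sum>t=1..T. ?G t \<bullet> (x t - xs)) = (\<Sum>c\<in>UNIV. \<Sum>t=1..T. ?G t $ c * (x t - xs) $ c)"
    unfolding inner_vec_def inner_real_def by (rule sum.swap)
  also have "\<dots> = (\<Sum>i=1..B. \<Sum>j\<in>block ds i. \<Sum>t=1..T. ?G t $ crd j * (x t - xs) $ crd j)"
    by (rule sum_consecutive_blocks[OF blocks, symmetric])
  also have "\<dots> \<le> (\<Sum>i=1..B. \<Sum>j\<in>block ds i.
      (\<delta> * ((x\<^sub>1 - xs) $ crd j)\<^sup>2 + D\<^sup>2 * ?r (crd j)) / (2 * \<eta>) + \<eta> * (Mb i)\<^sup>2 * ?r (crd j))"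
    by (intro sum_mono coord)
  also have "\<dots> = (\<Sum>i=1..B. \<Sum>j\<in>block ds i. (\<delta> * ((x\<^sub>1 - xs) $ crd j)\<^sup>2 + D\<^sup>2 * ?r (crd j)) / (2 * \<eta>))
      + (\<Sum>i=1..B. \<eta> * ((Mb i)\<^sup>2 * (\<Sum>j\<in>block ds i. ?r (crd j))))"
    by (simp add: sum.distrib sum_distrib_left mult.assoc)
  \<comment> \<open>These terms depend on the coordinate alone, so they are regrouped over all
    coordinates to apply the global row-norm bound.\<close>
  also have "(\<Sum>i=1..B. \<Sum>j\<in>block ds i. (\<delta> * ((x\<^sub>1 - xs) $ crd j)\<^sup>2 + D\<^sup>2 * ?r (crd j)) / (2 * \<eta>))
      = (\<Sum>c\<in>UNIV. (\<delta> * ((x\<^sub>1 - xs) $ c)\<^sup>2 + D\<^sup>2 * ?r c) / (2 * \<eta>))"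
    by (rule sum_consecutive_blocks[OF blocks])
  also have "\<dots> = (\<delta> * (norm (x\<^sub>1 - xs))\<^sup>2 + D\<^sup>2 * (\<Sum>c\<in>UNIV. ?r c)) / (2 * \<eta>)"
    by (simp add: norm_square_cart sum.distrib
        flip: sum_divide_distrib sum_distrib_left)
  also have "\<dots> \<le> (\<delta> * (norm (x\<^sub>1 - xs))\<^sup>2 + D\<^sup>2 * sqrt (real CARD('n) * (real B * real T))) / (2 * \<eta>)"
    using adagrad_bng_sum_row_norm[OF alg blocks, of T] pos
    by (intro divide_right_mono add_left_mono mult_left_mono) auto
  finally show ?thesis
    by simp
qed

text \<open>The quadratic form equals \<open>\<delta> * (norm y)\<^sup>2\<close> plus a sum with the
  nonnegative coefficients \<open>v $ c\<close>. This links the deterministic initial term to the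
  random \<open>H 1\<close>.\<close>

lemma weighted_norm_square_ge:
  assumes "\<delta> \<ge> 0" "\<And>c. v $ c \<ge> 0"
  shows "\<delta> * (norm y)\<^sup>2 \<le> (weighted_norm (\<delta> *\<^sub>R mat 1 + diag v) y)\<^sup>2"
proof -
  have "diag v *v y = v * y"
    by (simp add: diag_def matrix_vector_mult_def vec_eq_iff if_distrib[of "\<lambda>a. a * _"] cong: if_cong)
  then have "y \<bullet> ((\<delta> *\<^sub>R mat 1 + diag v) *v y) = \<delta> * (norm y)\<^sup>2 + (\<Sum>c\<in>UNIV. v $ c * (y $ c)\<^sup>2)"
    by (simp add: matrix_vector_mult_add_rdistrib inner_add_right power2_norm_eq_inner
        scaleR_matrix_vector_assoc[symmetric])
      (simp add: inner_vec_def power2_eq_square mult_ac)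
  moreover have "0 \<le> (\<Sum>c\<in>UNIV. v $ c * (y $ c)\<^sup>2)"
    using assms by (intro sum_nonneg) simp
  ultimately show ?thesis
    using assms by (simp add: weighted_norm_def)
qed

section \<open>Assembly: measurability, integrability and the chain of expectations\<close>

theorem theorem1:
  fixes P :: "'x measure" and M :: "'w measure"
    and F :: "real ^ 'n \<Rightarrow> 'x \<Rightarrow> real" and F' :: "real ^ 'n \<Rightarrow> 'x \<Rightarrow> real ^ 'n"
    and B :: nat and ds :: "nat \<Rightarrow> nat" and crd :: "nat \<Rightarrow> 'n"
    and \<xi> :: "nat \<Rightarrow> 'w \<Rightarrow> 'x"
    and x g s \<tau> :: "nat \<Rightarrow> 'w \<Rightarrow> real ^ 'n"
    and x\<^sub>1 xs :: "real ^ 'n" and \<delta> \<eta> D :: real and Mb :: "nat \<Rightarrow> real"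
    and f :: "real ^ 'n \<Rightarrow> real" and H :: "nat \<Rightarrow> 'w \<Rightarrow> real ^ 'n ^ 'n"
    and xbar :: "nat \<Rightarrow> 'w \<Rightarrow> real ^ 'n" and T :: nat
  assumes prob_P: "prob_space P" and prob_M: "prob_space M"
    and blocks: "consecutive_blocks B ds crd"
    and f_def: "f = expected_loss P F"
    and f_finite: "\<And>y. integrable P (F y)"
    and conv: "\<And>z. z \<in> space P \<Longrightarrow> convex_on UNIV (\<lambda>y. F y z)"
    and subgrad: "\<And>y z. z \<in> space P \<Longrightarrow> is_subgradient (\<lambda>y. F y z) y (F' y z)"
    and F'_meas: "(\<lambda>(y, z). F' y z) \<in> borel_measurable (borel \<Otimes>\<^sub>M P)"
    and minimizer: "\<And>y. f xs \<le> f y"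
    and samples_indep: "prob_space.indep_vars M (\<lambda>_. P) \<xi> {1..}"
    and samples_distr: "\<And>t. t \<ge> 1 \<Longrightarrow> distr M P (\<xi> t) = P"
    and \<delta>_pos: "\<delta> > 0" and \<eta>_pos: "\<eta> > 0"
    and algorithm: "\<And>\<omega>. \<omega> \<in> space M \<Longrightarrow>
          adagrad_bng B ds crd F' \<delta> \<eta> x\<^sub>1
            (\<lambda>t. \<xi> t \<omega>) (\<lambda>t. x t \<omega>) (\<lambda>t. g t \<omega>) (\<lambda>t. s t \<omega>) (\<lambda>t. \<tau> t \<omega>)"
    and nonzero: "\<And>t i. t \<ge> 1 \<Longrightarrow> i \<in> {1..B} \<Longrightarrow>
          AE \<omega> in M. block_norm ds crd i (F' (x t \<omega>) (\<xi> t \<omega>)) \<noteq> 0"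
    and bound_F': "\<And>t i. t \<ge> 1 \<Longrightarrow> i \<in> {1..B} \<Longrightarrow>
          AE \<omega> in M. block_norm ds crd i (F' (x t \<omega>) (\<xi> t \<omega>)) \<le> Mb i"
    and D_pos: "D > 0"
    and bound_x: "\<And>t. t \<ge> 1 \<Longrightarrow> AE \<omega> in M. infnorm (x t \<omega> - xs) \<le> D"
    and H_def: "\<And>t \<omega>. H t \<omega> = \<delta> *\<^sub>R mat 1 + diag (s t \<omega>)"
    and xbar_def: "\<And>t \<omega>. xbar t \<omega> = (1 / real t) *\<^sub>R (\<Sum>k=1..t. x k \<omega>)"
    and T_ge: "T \<ge> 1"
  shows "AE \<omega> in M.
      (\<integral>\<omega>'. (f (xbar T \<omega>') - f xs) \<partial>M)
        \<le> (weighted_norm (H 1 \<omega>) (x\<^sub>1 - xs))\<^sup>2 / (2 * \<eta> * real T)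
          + D\<^sup>2 * sqrt (real B * real CARD('n)) / (2 * \<eta> * sqrt (real T))
          + (\<Sum>i=1..B. \<eta> * (\<integral>\<omega>'. ((Mb i)\<^sup>2 *
                (\<Sum>j\<in>block ds i. row_norm (\<lambda>t. g t \<omega>') T (crd j))) \<partial>M) / real T)
    \<and> (weighted_norm (H 1 \<omega>) (x\<^sub>1 - xs))\<^sup>2 / (2 * \<eta> * real T)
          + D\<^sup>2 * sqrt (real B * real CARD('n)) / (2 * \<eta> * sqrt (real T))
          + (\<Sum>i=1..B. \<eta> * (\<integral>\<omega>'. ((Mb i)\<^sup>2 *
                (\<Sum>j\<in>block ds i. row_norm (\<lambda>t. g t \<omega>') T (crd j))) \<partial>M) / real T)
        \<le> (weighted_norm (H 1 \<omega>) (x\<^sub>1 - xs))\<^sup>2 / (2 * \<eta> * real T)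
          + D\<^sup>2 * sqrt (real B * real CARD('n)) / (2 * \<eta> * sqrt (real T))
          + (\<Sum>i=1..B. \<eta> * (Mb i)\<^sup>2 * sqrt (real (ds i)) / sqrt (real T))"
proof -
  interpret prob_space M by (rule prob_M)
  interpret P: prob_space P by (rule prob_P)
  define V where "V t \<omega> = F' (x t \<omega>) (\<xi> t \<omega>)" for t \<omega>
  define r where "r \<omega> c = row_norm (\<lambda>t. g t \<omega>) T c" for \<omega> c
  define R where "R i \<omega> = (Mb i)\<^sup>2 * (\<Sum>j\<in>block ds i. r \<omega> (crd j))" for i \<omega>
  note alg = algorithm
  have \<xi> [measurable]: "\<xi> t \<in> M \<rightarrow>\<^sub>M P" if "t \<ge> 1" for t
    using samples_indep that unfolding indep_vars_def2 by auto

  have "\<forall>c. \<exists>i. i \<in> {1..B} \<and> (\<exists>j\<in>block ds i. crd j = c)"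
    using coordinate_in_block[OF blocks] by blast
  then obtain blk where blk: "\<And>c. blk c \<in> {1..B}" "\<And>c. \<exists>j\<in>block ds (blk c). crd j = c"
    by metis
  \<comment> \<open>Fixing a block \<open>blk c\<close> for each coordinate makes the normalized
    coordinate a measurable function \<open>\<gamma>\<close> of the subgradient alone.\<close>
  define \<gamma> where "\<gamma> v c = v $ c / block_norm ds crd (blk c) v" for v :: "real ^ 'n" and c
  have \<gamma>_meas: "(\<lambda>w. \<gamma> (h w) c) \<in> borel_measurable N"
    if [measurable]: "h \<in> borel_measurable N" for h :: "'b \<Rightarrow> real ^ 'n" and N c
    unfolding \<gamma>_def block_norm_def by measurable
  have g_eq: "g t \<omega> $ c = \<gamma> (V t \<omega>) c" if "\<omega> \<in> space M" "t \<ge> 1" for t \<omega> c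
    using alg[OF that(1)] that(2) blk[of c] unfolding adagrad_bng_def \<gamma>_def V_def by metis

  \<comment> \<open>The iterates alone are not Markovian; adding the accumulated squares makes the pair a recursion
    driven by the samples.\<close>
  define \<Phi> where "\<Phi> = (\<lambda>(y, q) z. (\<chi> c. y $ c - \<eta> * F' y z $ c / (\<delta> + sqrt (q $ c + (\<gamma> (F' y z) c)\<^sup>2)),
    \<chi> c. q $ c + (\<gamma> (F' y z) c)\<^sup>2))"
  define X where "X t \<omega> = (x t \<omega>, \<chi> c. \<Sum>k=1..<t. (g k \<omega> $ c)\<^sup>2)" for t \<omega>
  have \<Phi>: "(\<lambda>(y, z). \<Phi> y z) \<in> (borel \<Otimes>\<^sub>M borel) \<Otimes>\<^sub>M P \<rightarrow>\<^sub>M borel \<Otimes>\<^sub>M borel"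
  proof -
    let ?N = "(borel \<Otimes>\<^sub>M borel) \<Otimes>\<^sub>M P"
    let ?v = "\<lambda>w. F' (fst (fst w)) (snd w)"
    have "(\<lambda>w. (fst (fst w), snd w)) \<in> ?N \<rightarrow>\<^sub>M borel \<Otimes>\<^sub>M P"
      by measurable
    from measurable_compose[OF this F'_meas] have v [measurable]: "?v \<in> borel_measurable ?N"
      by simp
    note [measurable] = \<gamma>_meas[OF v]
    have "(\<lambda>w. (\<chi> c. fst (fst w) $ c - \<eta> * ?v w $ c / (\<delta> + sqrt (snd (fst w) $ c + (\<gamma> (?v w) c)\<^sup>2)),
        \<chi> c. snd (fst w) $ c + (\<gamma> (?v w) c)\<^sup>2)) \<in> ?N \<rightarrow>\<^sub>M borel \<Otimes>\<^sub>M borel"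
      by (intro measurable_Pair borel_measurable_cart; simp; measurable)
    then show ?thesis
      by (simp add: \<Phi>_def case_prod_beta')
  qed
  have init: "X 1 \<omega> = (x\<^sub>1, 0)" if "\<omega> \<in> space M" for \<omega>
    using alg[OF that] by (simp add: X_def adagrad_bng_def vec_eq_iff)
  have step: "X (Suc t) \<omega> = \<Phi> (X t \<omega>) (\<xi> t \<omega>)" if "t \<ge> 1" "\<omega> \<in> space M" for t \<omega>
  proof -
    \<comment> \<open>The state at time \<open>t\<close> stores the squares strictly before
      \<open>t\<close>, since \<open>g t\<close> already involves sample \<open>t\<close>. Adding
      the current square first gives exactly the row norm in the weight of this step.\<close>
    have q: "(\<Sum>k=1..<t. (g k \<omega> $ c)\<^sup>2) + (\<gamma> (V t \<omega>) c)\<^sup>2 = (\<Sum>k=1..t. (g k \<omega> $ c)\<^sup>2)" for c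
      using that g_eq[OF that(2,1)] by (simp add: sum.last_plus add.commute)
    have "x (Suc t) \<omega> $ c = x t \<omega> $ c - \<eta> * V t \<omega> $ c
        / (\<delta> + sqrt ((\<Sum>k=1..<t. (g k \<omega> $ c)\<^sup>2) + (\<gamma> (V t \<omega>) c)\<^sup>2))" for c
      using adagrad_bng_step[OF alg[OF that(2)] blocks that(1), of c]
      unfolding q unfolding V_def row_norm_def L2_set_def .
    then show ?thesis
      using q by (simp add: X_def \<Phi>_def V_def vec_eq_iff atLeastLessThanSuc_atLeastAtMost)
  qed
  have y0: "(x\<^sub>1, 0) \<in> space (borel \<Otimes>\<^sub>M borel)"
    by (simp add: space_pair_measure)
  note joint = joint_distribution_recursion[where X = X and k = fst, OF samples_indep \<Phi> y0]
  have x_meas [measurable]: "x t \<in> borel_measurable M" if "t \<ge> 1" for t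
  proof -
    have "(\<lambda>\<omega>. fst (X t \<omega>)) \<in> borel_measurable M"
      by (rule joint(1)[OF init step measurable_fst that])
    then show ?thesis
      by (simp add: X_def)
  qed
  have x_joint: "distr M borel (x t) \<Otimes>\<^sub>M P = distr M (borel \<Otimes>\<^sub>M P) (\<lambda>\<omega>. (x t \<omega>, \<xi> t \<omega>))"
    if "t \<ge> 1" for t
  proof -
    have "distr M borel (\<lambda>\<omega>. fst (X t \<omega>)) \<Otimes>\<^sub>M distr M P (\<xi> t)
        = distr M (borel \<Otimes>\<^sub>M P) (\<lambda>\<omega>. (fst (X t \<omega>), \<xi> t \<omega>))"
      by (rule joint(2)[OF init step measurable_fst that])
    then show ?thesis
      using samples_distr[OF that] by (simp add: X_def)
  qed
  have V_meas [measurable]: "V t \<in> borel_measurable M" if [simp]: "t \<ge> 1" for t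
  proof -
    have "(\<lambda>\<omega>. (x t \<omega>, \<xi> t \<omega>)) \<in> M \<rightarrow>\<^sub>M borel \<Otimes>\<^sub>M P"
      using x_meas \<xi> that by (intro measurable_Pair) auto
    from measurable_compose[OF this F'_meas] show ?thesis
      by (simp add: V_def[abs_def])
  qed
  have g_meas: "(\<lambda>\<omega>. g t \<omega> $ c) \<in> borel_measurable M" if "t \<ge> 1" for t c
    using \<gamma>_meas[OF V_meas[OF that], of c] by (rule measurable_cong[THEN iffD1, rotated]) (simp add: g_eq[OF _ that])
  have r_meas [measurable]: "(\<lambda>\<omega>. r \<omega> c) \<in> borel_measurable M" for c
    unfolding r_def row_norm_def by (intro borel_measurable_L2_set g_meas) auto

  have f_convex: "convex_on UNIV f"
    unfolding f_def using f_finite conv by (rule convex_on_expected_loss)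
  \<comment> \<open>A finite convex function on a finite-dimensional space is continuous. This
    yields both Borel measurability of \<open>f\<close> and its boundedness on compact
    balls.\<close>
  then have f_cont: "continuous_on UNIV f"
    by (intro convex_on_continuous) auto
  then have f_meas [measurable]: "f \<in> borel_measurable borel"
    by (rule borel_measurable_continuous_onI)

  \<comment> \<open>Only finitely many times and blocks occur, so all the almost sure bounds hold
    simultaneously outside one null set.\<close>
  have good: "AE \<omega> in M. \<forall>t\<in>{1..T}. infnorm (x t \<omega> - xs) \<le> D \<and>
      (\<forall>i\<in>{1..B}. block_norm ds crd i (V t \<omega>) \<le> Mb i)"
    using bound_x bound_F' unfolding V_def by (intro AE_finite_allI AE_conjI) auto

  have inner_int: "integrable M (\<lambda>\<omega>. V t \<omega> \<bullet> (x t \<omega> - xs))" if t: "t \<in> {1..T}" for t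
  proof (rule integrable_const_bound)
    \<comment> \<open>The first factor bounds the 1-norm of the subgradient coordinate by
      coordinate; the second bounds the Euclidean distance by the maximum norm times the square root
      of the dimension.\<close>
    show "AE \<omega> in M. norm (V t \<omega> \<bullet> (x t \<omega> - xs)) \<le> (\<Sum>c\<in>UNIV. Mb (blk c)) * (sqrt DIM(real ^ 'n) * D)"
      using good
    proof eventually_elim
      case (elim \<omega>)
      have "\<bar>V t \<omega> $ c\<bar> \<le> Mb (blk c)" for c
        using abs_nth_le_block_norm[of _ ds "blk c" "V t \<omega>" crd] blk[of c] elim t by fastforce
      then have V: "norm (V t \<omega>) \<le> (\<Sum>c\<in>UNIV. Mb (blk c))"
        by (intro order_trans[OF norm_le_l1_cart] sum_mono)
      have "norm (x t \<omega> - xs) \<le> sqrt DIM(real ^ 'n) * infnorm (x t \<omega> - xs)"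
        by (rule norm_le_infnorm)
      also have "\<dots> \<le> sqrt DIM(real ^ 'n) * D"
        using elim t by (intro mult_left_mono) auto
      finally have "norm (x t \<omega> - xs) \<le> sqrt DIM(real ^ 'n) * D" .
      with V show ?case
        using order_trans[OF norm_ge_zero V]
        by (intro order_trans[OF Cauchy_Schwarz_ineq2[folded real_norm_def]] mult_mono) auto
    qed
    show "(\<lambda>\<omega>. V t \<omega> \<bullet> (x t \<omega> - xs)) \<in> borel_measurable M"
      using V_meas x_meas t by (intro borel_measurable_inner borel_measurable_diff) auto
  qed

  have f_int: "integrable M (\<lambda>\<omega>. f (x t \<omega>) - f xs)" if t: "t \<in> {1..T}" for t
  proof -
    \<comment> \<open>Almost surely the iterate lies in this ball, on which the continuous
      \<open>f\<close> is bounded.\<close>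
    have "compact ((\<lambda>y. f y - f xs) ` cball xs (sqrt DIM(real ^ 'n) * D))"
      by (intro compact_continuous_image continuous_intros continuous_on_subset[OF f_cont]) auto
    then have "bounded ((\<lambda>y. f y - f xs) ` cball xs (sqrt DIM(real ^ 'n) * D))"
      by (rule compact_imp_bounded)
    then obtain K where K: "\<And>y. y \<in> cball xs (sqrt DIM(real ^ 'n) * D) \<Longrightarrow> norm (f y - f xs) \<le> K"
      by (auto simp only: bounded_iff ball_simps)
    show ?thesis
    proof (rule integrable_const_bound)
      show "AE \<omega> in M. norm (f (x t \<omega>) - f xs) \<le> K"
        using good
      proof eventually_elim
        case (elim \<omega>)
        have "norm (x t \<omega> - xs) \<le> sqrt DIM(real ^ 'n) * infnorm (x t \<omega> - xs)"
          by (rule norm_le_infnorm)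
        also have "\<dots> \<le> sqrt DIM(real ^ 'n) * D"
          using elim t by (intro mult_left_mono) auto
        finally show ?case
          by (intro K) (simp add: dist_norm norm_minus_commute)
      qed
      show "(\<lambda>\<omega>. f (x t \<omega>) - f xs) \<in> borel_measurable M"
        using measurable_compose[OF x_meas f_meas] t
        by (intro borel_measurable_diff borel_measurable_const) auto
    qed
  qed

  have r_nonneg: "0 \<le> r \<omega> c" for \<omega> c
    by (simp add: r_def row_norm_def)
  have R_bound: "0 \<le> R i \<omega>" "R i \<omega> \<le> (Mb i)\<^sup>2 * sqrt (real (ds i) * real T)"
    if "i \<in> {1..B}" "\<omega> \<in> space M" for i \<omega>
    unfolding R_def r_def
    using adagrad_bng_sum_row_norm_block[OF alg[OF that(2)] that(1), of T] r_nonneg[unfolded r_def]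
    by (auto intro!: mult_left_mono mult_nonneg_nonneg sum_nonneg)
  have R_int: "integrable M (R i)" if i: "i \<in> {1..B}" for i
  proof (rule integrable_const_bound)
    show "AE \<omega> in M. norm (R i \<omega>) \<le> (Mb i)\<^sup>2 * sqrt (real (ds i) * real T)"
      using R_bound[OF i] by (intro AE_I2) simp
    show "R i \<in> borel_measurable M"
      unfolding R_def[abs_def] by measurable
  qed

  have sum_R_int: "integrable M (\<lambda>\<omega>. \<Sum>i=1..B. \<eta> * R i \<omega>)"
    by (intro Bochner_Integration.integrable_sum integrable_mult_right R_int)

  let ?f = "\<lambda>\<omega>. f (xbar T \<omega>) - f xs"
  let ?c = "\<delta> * (norm (x\<^sub>1 - xs))\<^sup>2" and ?d = "D\<^sup>2 * sqrt (real CARD('n) * (real B * real T))"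
  \<comment> \<open>Jensen's inequality for the convex combination with equal weights
    \<open>1 / T\<close>.\<close>
  have jensen: "?f \<omega> \<le> (\<Sum>t=1..T. f (x t \<omega>) - f xs) / real T" for \<omega>
  proof -
    have "f (\<Sum>t=1..T. (1 / real T) *\<^sub>R x t \<omega>) \<le> (\<Sum>t=1..T. 1 / real T * f (x t \<omega>))"
      using T_ge f_convex by (intro convex_on_sum) auto
    then show ?thesis
      using T_ge
      by (simp add: xbar_def scaleR_sum_right sum_subtractf diff_divide_distrib
          flip: sum_divide_distrib)
  qed
  have sum_int: "integrable M (\<lambda>\<omega>. (\<Sum>t=1..T. f (x t \<omega>) - f xs) / real T)"
    using f_int by (intro integrable_divide integrable_sum) auto
  have f_bar_int: "integrable M ?f"
  proof (rule Bochner_Integration.integrable_bound[OF sum_int])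
    have "xbar T \<in> borel_measurable M"
      unfolding xbar_def[abs_def]
      using x_meas by (intro borel_measurable_scaleR borel_measurable_sum borel_measurable_const) auto
    then show "?f \<in> borel_measurable M"
      by measurable
    \<comment> \<open>Minimality of \<open>xs\<close> makes the excess at the average nonnegative,
      so the upper bound from \<open>jensen\<close> also dominates its absolute value.\<close>
    show "AE \<omega> in M. norm (?f \<omega>) \<le> norm ((\<Sum>t=1..T. f (x t \<omega>) - f xs) / real T)"
      using jensen minimizer by (intro AE_I2) (smt (verit) real_norm_def)
  qed
  have "(\<integral>\<omega>. ?f \<omega> \<partial>M) \<le> (\<integral>\<omega>. (\<Sum>t=1..T. f (x t \<omega>) - f xs) / real T \<partial>M)"
    using f_bar_int sum_int jensen by (intro integral_mono)
  also have "\<dots> = (\<Sum>t=1..T. \<integral>\<omega>. f (x t \<omega>) - f xs \<partial>M) / real T"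
    using f_int by (simp only: integral_divide_zero Bochner_Integration.integral_sum)
  also have "\<dots> \<le> (\<Sum>t=1..T. \<integral>\<omega>. V t \<omega> \<bullet> (x t \<omega> - xs) \<partial>M) / real T"
  proof (intro divide_right_mono sum_mono)
    fix t assume t: "t \<in> {1..T}"
    then have "t \<ge> 1"
      by simp
    show "(\<integral>\<omega>. f (x t \<omega>) - f xs \<partial>M) \<le> (\<integral>\<omega>. V t \<omega> \<bullet> (x t \<omega> - xs) \<partial>M)"
      unfolding f_def V_def
      by (rule expected_excess_le_expected_subgradient[OF prob_P x_meas[OF \<open>t \<ge> 1\<close>] \<xi>[OF \<open>t \<ge> 1\<close>]
            x_joint[OF \<open>t \<ge> 1\<close>] f_finite subgrad F'_meas f_meas[unfolded f_def]
            inner_int[OF t, unfolded V_def] f_int[OF t, unfolded f_def]])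
  qed simp
  also have "\<dots> = (\<integral>\<omega>. (\<Sum>t=1..T. V t \<omega> \<bullet> (x t \<omega> - xs)) \<partial>M) / real T"
    using inner_int by (simp only: Bochner_Integration.integral_sum)
  \<comment> \<open>The pathwise regret bound is inserted under the expectation. Its first two terms
    are deterministic; only the row norms in \<open>R\<close> remain random.\<close>
  also have "\<dots> \<le> (\<integral>\<omega>. (?c + ?d) / (2 * \<eta>) + (\<Sum>i=1..B. \<eta> * R i \<omega>) \<partial>M) / real T"
  proof (intro divide_right_mono integral_mono_AE)
    show "AE \<omega> in M. (\<Sum>t=1..T. V t \<omega> \<bullet> (x t \<omega> - xs)) \<le> (?c + ?d) / (2 * \<eta>) + (\<Sum>i=1..B. \<eta> * R i \<omega>)"
      using good AE_space
    proof eventually_elim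
      case (elim \<omega>)
      show ?case
        unfolding V_def R_def r_def
        by (rule adagrad_bng_regret[OF alg[OF elim(2)] blocks \<delta>_pos \<eta>_pos])
          (use elim(1) in \<open>auto simp: V_def\<close>)
    qed
    show "integrable M (\<lambda>\<omega>. \<Sum>t=1..T. V t \<omega> \<bullet> (x t \<omega> - xs))"
      by (intro Bochner_Integration.integrable_sum inner_int)
    show "integrable M (\<lambda>\<omega>. (?c + ?d) / (2 * \<eta>) + (\<Sum>i=1..B. \<eta> * R i \<omega>))"
      by (intro Bochner_Integration.integrable_add integrable_const sum_R_int)
  qed simp
  also have "\<dots> = ((?c + ?d) / (2 * \<eta>) + (\<Sum>i=1..B. \<eta> * (\<integral>\<omega>. R i \<omega> \<partial>M))) / real T"
    using R_int
    by (simp add: Bochner_Integration.integral_add[OF integrable_const sum_R_int[unfolded One_nat_def]]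
        Bochner_Integration.integral_sum prob_space)
  also have "\<dots> = ?c / (2 * \<eta> * real T) + ?d / (2 * \<eta> * real T) + (\<Sum>i=1..B. \<eta> * (\<integral>\<omega>. R i \<omega> \<partial>M) / real T)"
    by (simp add: add_divide_distrib sum_divide_distrib)
  \<comment> \<open>Here \<open>sqrt T / T\<close> becomes \<open>1 / sqrt T\<close>.\<close>
  also have "?d / (2 * \<eta> * real T) = D\<^sup>2 * sqrt (real B * real CARD('n)) / (2 * \<eta> * sqrt (real T))"
    using T_ge \<eta>_pos by (simp add: real_sqrt_mult field_simps)
  finally have main: "(\<integral>\<omega>. ?f \<omega> \<partial>M) \<le> ?c / (2 * \<eta> * real T)
      + D\<^sup>2 * sqrt (real B * real CARD('n)) / (2 * \<eta> * sqrt (real T))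
      + (\<Sum>i=1..B. \<eta> * (\<integral>\<omega>. R i \<omega> \<partial>M) / real T)" .

  have "(\<Sum>i=1..B. \<eta> * (\<integral>\<omega>. R i \<omega> \<partial>M) / real T)
      \<le> (\<Sum>i=1..B. \<eta> * (Mb i)\<^sup>2 * sqrt (real (ds i)) / sqrt (real T))"
  proof (rule sum_mono)
    fix i assume i: "i \<in> {1..B}"
    have "(\<integral>\<omega>. R i \<omega> \<partial>M) \<le> (Mb i)\<^sup>2 * sqrt (real (ds i) * real T)"
      using R_int[OF i] R_bound(2)[OF i] by (intro integral_le_const AE_I2)
    then have "\<eta> * (\<integral>\<omega>. R i \<omega> \<partial>M) / real T \<le> \<eta> * ((Mb i)\<^sup>2 * sqrt (real (ds i) * real T)) / real T"
      using \<eta>_pos by (intro divide_right_mono mult_left_mono) auto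
    also have "\<dots> = \<eta> * (Mb i)\<^sup>2 * sqrt (real (ds i)) / sqrt (real T)"
      using T_ge by (simp add: real_sqrt_mult field_simps)
    finally show "\<eta> * (\<integral>\<omega>. R i \<omega> \<partial>M) / real T \<le> \<eta> * (Mb i)\<^sup>2 * sqrt (real (ds i)) / sqrt (real T)" .
  qed
  \<comment> \<open>The outcome enters only now, after the expectation has been bounded: the entries
    of \<open>s 1 \<omega>\<close> are row norms, hence nonnegative, so the \<open>H 1\<close> form
    dominates the deterministic term at every outcome.\<close>
  moreover have "?c / (2 * \<eta> * real T) \<le> (weighted_norm (H 1 \<omega>) (x\<^sub>1 - xs))\<^sup>2 / (2 * \<eta> * real T)"
    if "\<omega> \<in> space M" for \<omega>
  proof -
    have "s 1 \<omega> = (\<chi> j. row_norm (\<lambda>t. g t \<omega>) 1 j)"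
      using alg[OF that] unfolding adagrad_bng_def by simp
    then have "?c \<le> (weighted_norm (H 1 \<omega>) (x\<^sub>1 - xs))\<^sup>2"
      unfolding H_def using \<delta>_pos by (intro weighted_norm_square_ge) (auto simp: row_norm_def)
    then show ?thesis
      using \<eta>_pos by (intro divide_right_mono) auto
  qed
  ultimately show ?thesis
    using main unfolding R_def r_def by (intro AE_I2) fastforce
qed

end
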